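(* Let $P, Q$ and $R$ be three finite connected posets. Then $$\langle \delta(P), Q\otimes R\rangle=\frac{1}{|\min(P)|}\langle P, Q\triangleright R\rangle.$$
   Context: $\mathbb{U}$ is the linear species of finite connected posets. For finite connected posets $P$ on $X_1$ and $Q$ on $X_2$ and $v\in X_2$, $P\searrow_v Q$ is the poset on $X_1\sqcup X_2$ obtained from the Hasse graphs of $P$ and $Q$ by adding an oriented edge from $v$ (in the Hasse graph of $Q$) to every minimal vertex of the Hasse graph of $P$. The product $\triangleright$ is $P\triangleright Q=\sum_{v\in \min(Q)}P\searrow_v Q$, where $\min(Q)$ is the set of minimal elements. For a subset $I$ of a finite connected poset $P$, let $I_-=\{x\notin I : \exists y\in I,\ x\le_P y\}$; write $I\circledcirc P$ when $I_-$ is a singleton contained in $\min(P)$ and $I$ is a connected component of the set $\{x\in P : I_-<_P x\}$. The coproduct is $\delta(P)=\frac{1}{|\min(P)|}\sum_{I\circledcirc P} I\otimes P\setminus I$ (with induced orders). For a poset $P$, $\mathrm{Aut}(P)$ is its automorphism group and $\sigma(P)=|\mathrm{Aut}(P)|$; the pairing is $\langle Q,R\rangle=\sigma(Q)$ if $Q\cong R$ and $0$ otherwise (i.e., the number of isomorphisms from $Q$ to $R$), extended bilinearly, with $\langle Q\otimes R, Q'\otimes R'\rangle=\langle Q,Q'\rangle\langle R,R'\rangle$. *)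

theory Defs
  imports Complex_Main "HOL-Library.FuncSet" "HOL-Library.Poly_Mapping"
begin

text \<open>
  A poset is a pair of an underlying set and a (reflexive) order relation on it, where
  \<open>(x, y)\<close> in the relation means \<open>x \<le> y\<close>.
\<close>

type_synonym 'a poset = "'a set \<times> 'a rel"

definition subposet :: "'a poset \<Rightarrow> 'a set \<Rightarrow> 'a poset" where
  "subposet P S = (S, Restr (snd P) S)"

text \<open>
  \<open>zigzag P\<close> relates two points joined by a path in which consecutive points are comparable;
  its classes are the connected components of \<open>P\<close>.
\<close>

definition zigzag :: "'a poset \<Rightarrow> 'a rel" where
  "zigzag P = Restr ((snd P \<union> (snd P)\<inverse>)\<^sup>*) (fst P)"

definition components :: "'a poset \<Rightarrow> 'a set set" where
  "components P = fst P // zigzag P"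

text \<open>The empty poset is not connected.\<close>

definition finite_connected_poset :: "'a poset \<Rightarrow> bool" where
  "finite_connected_poset P \<longleftrightarrow>
     finite (fst P) \<and> partial_order_on (fst P) (snd P) \<and>
     fst P \<noteq> {} \<and> (\<forall>x\<in>fst P. \<forall>y\<in>fst P. (x, y) \<in> zigzag P)"

definition min_elems :: "'a poset \<Rightarrow> 'a set" where
  "min_elems P = {x \<in> fst P. \<forall>y\<in>fst P. (y, x) \<in> snd P \<longrightarrow> y = x}"

text \<open>Edges of the Hasse graph, oriented upwards.\<close>

definition hasse :: "'a poset \<Rightarrow> 'a rel" where
  "hasse P = {(x, y) \<in> snd P. x \<noteq> y \<and>
     (\<forall>z\<in>fst P. (x, z) \<in> snd P \<and> (z, y) \<in> snd P \<longrightarrow> z = x \<or> z = y)}"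

definition graft_edges :: "'a poset \<Rightarrow> 'b \<Rightarrow> 'b poset \<Rightarrow> ('a + 'b) rel" where
  "graft_edges P v Q =
     map_prod Inl Inl ` hasse P \<union> map_prod Inr Inr ` hasse Q \<union> {Inr v} \<times> Inl ` min_elems P"

text \<open>
  \<open>graft P v Q\<close> is \<open>P \<searrow>\<^sub>v Q\<close>: the poset on the disjoint union whose order is reachability
  in the enlarged Hasse graph.
\<close>

definition graft :: "'a poset \<Rightarrow> 'b \<Rightarrow> 'b poset \<Rightarrow> ('a + 'b) poset" where
  "graft P v Q = (fst P <+> fst Q, Restr ((graft_edges P v Q)\<^sup>*) (fst P <+> fst Q))"

text \<open>
  Linear combinations of posets are finitely supported functions \<open>'a poset \<Rightarrow>\<^sub>0 'k\<close>; tensors are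
  finitely supported functions on pairs of posets, these pairs being the standard basis of the
  tensor product of two free modules.
\<close>

definition basis :: "'a poset \<Rightarrow> 'a poset \<Rightarrow>\<^sub>0 'k::field_char_0" where
  "basis P = Poly_Mapping.single P 1"

definition tensor :: "'a poset \<Rightarrow> 'b poset \<Rightarrow> ('a poset \<times> 'b poset) \<Rightarrow>\<^sub>0 'k::field_char_0" where
  "tensor P Q = Poly_Mapping.single (P, Q) 1"

definition scale :: "'k::field_char_0 \<Rightarrow> ('x \<Rightarrow>\<^sub>0 'k) \<Rightarrow> ('x \<Rightarrow>\<^sub>0 'k)" where
  "scale c u = Poly_Mapping.map ((*) c) u"

definition tri_prod :: "'a poset \<Rightarrow> 'b poset \<Rightarrow> ('a + 'b) poset \<Rightarrow>\<^sub>0 'k::field_char_0" where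
  "tri_prod P Q = (\<Sum>v\<in>min_elems Q. basis (graft P v Q))"

text \<open>\<open>lower_part P I\<close> is \<open>I\<^sub>-\<close>.\<close>

definition lower_part :: "'a poset \<Rightarrow> 'a set \<Rightarrow> 'a set" where
  "lower_part P I = {x \<in> fst P. x \<notin> I \<and> (\<exists>y\<in>I. (x, y) \<in> snd P)}"

text \<open>\<open>admissible I P\<close> is the relation \<open>I \<circledcirc> P\<close>.\<close>

definition admissible :: "'a set \<Rightarrow> 'a poset \<Rightarrow> bool" where
  "admissible I P \<longleftrightarrow>
     I \<subseteq> fst P \<and> is_singleton (lower_part P I) \<and> lower_part P I \<subseteq> min_elems P \<and>
     I \<in> components (subposet P
           {x \<in> fst P. \<forall>v\<in>lower_part P I. (v, x) \<in> snd P \<and> v \<noteq> x})"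

definition delta :: "'a poset \<Rightarrow> ('a poset \<times> 'a poset) \<Rightarrow>\<^sub>0 'k::field_char_0" where
  "delta P = scale (1 / of_nat (card (min_elems P)))
     (\<Sum>I | admissible I P. tensor (subposet P I) (subposet P (fst P - I)))"

text \<open>
  Isomorphisms are taken extensional, so that two isomorphisms agreeing on the underlying set
  are counted once.
\<close>

definition isos :: "'a poset \<Rightarrow> 'b poset \<Rightarrow> ('a \<Rightarrow> 'b) set" where
  "isos P Q = {f \<in> fst P \<rightarrow>\<^sub>E fst Q. bij_betw f (fst P) (fst Q) \<and>
     (\<forall>x\<in>fst P. \<forall>y\<in>fst P. (x, y) \<in> snd P \<longleftrightarrow> (f x, f y) \<in> snd Q)}"

definition isomorphic :: "'a poset \<Rightarrow> 'b poset \<Rightarrow> bool" where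
  "isomorphic P Q \<longleftrightarrow> isos P Q \<noteq> {}"

definition Aut :: "'a poset \<Rightarrow> ('a \<Rightarrow> 'a) set" where
  "Aut P = isos P P"

definition sigma :: "'a poset \<Rightarrow> nat" where
  "sigma P = card (Aut P)"

definition poset_pairing :: "'a poset \<Rightarrow> 'b poset \<Rightarrow> 'k::field_char_0" where
  "poset_pairing Q R = (if isomorphic Q R then of_nat (sigma Q) else 0)"

definition bilinear_ext ::
    "('x \<Rightarrow> 'y \<Rightarrow> 'k::field_char_0) \<Rightarrow> ('x \<Rightarrow>\<^sub>0 'k) \<Rightarrow> ('y \<Rightarrow>\<^sub>0 'k) \<Rightarrow> 'k" where
  "bilinear_ext b u w = (\<Sum>x\<in>Poly_Mapping.keys u. \<Sum>y\<in>Poly_Mapping.keys w.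
     Poly_Mapping.lookup u x * Poly_Mapping.lookup w y * b x y)"

definition pairing ::
    "('a poset \<Rightarrow>\<^sub>0 'k::field_char_0) \<Rightarrow> ('b poset \<Rightarrow>\<^sub>0 'k) \<Rightarrow> 'k" where
  "pairing = bilinear_ext poset_pairing"

definition tensor_pairing ::
    "(('a poset \<times> 'b poset) \<Rightarrow>\<^sub>0 'k::field_char_0) \<Rightarrow> (('c poset \<times> 'd poset) \<Rightarrow>\<^sub>0 'k) \<Rightarrow> 'k" where
  "tensor_pairing = bilinear_ext
     (\<lambda>(Q, R) (Q', R'). poset_pairing Q Q' * poset_pairing R R')"

end

theory Submission
  imports Defs
begin

text \<open>
  The pairing counts isomorphisms, so by bilinearity both sides are cardinalities up to the common
  factor. In \<open>Q \<searrow>\<^sub>v R\<close> with \<open>v\<close> minimal in \<open>R\<close>, the only element of \<open>R\<close> comparable to an element of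
  \<open>Q\<close> is \<open>v\<close>, which lies below all of \<open>Q\<close>. Hence an isomorphism from \<open>P\<close> to \<open>Q \<searrow>\<^sub>v R\<close> amounts to an
  admissible \<open>I\<close>, the preimage of \<open>Q\<close>, together with isomorphisms from \<open>I\<close> to \<open>Q\<close> and from \<open>P - I\<close>
  to \<open>R\<close>; the vertex \<open>v\<close> is recovered as the image of the unique element of \<open>I\<^sub>-\<close>.
\<close>

section \<open>Linearity of the bilinear extension\<close>

text \<open>Supports can shrink through cancellation when vectors are added or scaled. Summing over
  fixed finite supersets of the supports only adds terms with coefficient 0 and lets vectors with
  different supports be compared termwise.\<close>

lemma bilinear_ext_superset:
  assumes "finite A" "Poly_Mapping.keys u \<subseteq> A" "finite B" "Poly_Mapping.keys w \<subseteq> B"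
  shows "bilinear_ext b u w =
    (\<Sum>x\<in>A. \<Sum>y\<in>B. Poly_Mapping.lookup u x * Poly_Mapping.lookup w y * b x y)"
proof -
  have "bilinear_ext b u w = (\<Sum>x\<in>A. \<Sum>y\<in>Poly_Mapping.keys w.
      Poly_Mapping.lookup u x * Poly_Mapping.lookup w y * b x y)"
    unfolding bilinear_ext_def
    by (rule sum.mono_neutral_left) (use assms in \<open>auto simp: in_keys_iff\<close>)
  also have "\<dots> = (\<Sum>x\<in>A. \<Sum>y\<in>B. Poly_Mapping.lookup u x * Poly_Mapping.lookup w y * b x y)"
    by (intro sum.cong refl sum.mono_neutral_left) (use assms in \<open>auto simp: in_keys_iff\<close>)
  finally show ?thesis .
qed

lemma bilinear_ext_add_left: "bilinear_ext b (u + u') w = bilinear_ext b u w + bilinear_ext b u' w"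
proof -
  let ?A = "Poly_Mapping.keys u \<union> Poly_Mapping.keys u'"
  have "Poly_Mapping.keys (u + u') \<subseteq> ?A" by (rule Poly_Mapping.keys_add)
  then show ?thesis
    by (simp add: bilinear_ext_superset[of ?A _ "Poly_Mapping.keys w"] lookup_add
        distrib_right sum.distrib)
qed

lemma bilinear_ext_add_right: "bilinear_ext b u (w + w') = bilinear_ext b u w + bilinear_ext b u w'"
proof -
  let ?B = "Poly_Mapping.keys w \<union> Poly_Mapping.keys w'"
  have "Poly_Mapping.keys (w + w') \<subseteq> ?B" by (rule Poly_Mapping.keys_add)
  then show ?thesis
    by (simp add: bilinear_ext_superset[of "Poly_Mapping.keys u" _ ?B] lookup_add
        distrib_right distrib_left sum.distrib)
qed

lemma bilinear_ext_sum_left: "bilinear_ext b (\<Sum>i\<in>A. u i) w = (\<Sum>i\<in>A. bilinear_ext b (u i) w)"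
  \<comment> \<open>For infinite \<open>A\<close> both sums take the default value 0.\<close>
  by (induction A rule: infinite_finite_induct)
    (auto simp: bilinear_ext_add_left, auto simp: bilinear_ext_def)

lemma bilinear_ext_sum_right: "bilinear_ext b u (\<Sum>i\<in>A. w i) = (\<Sum>i\<in>A. bilinear_ext b u (w i))"
  by (induction A rule: infinite_finite_induct)
    (auto simp: bilinear_ext_add_right, auto simp: bilinear_ext_def)

lemma lookup_scale: "Poly_Mapping.lookup (scale c u) x = c * Poly_Mapping.lookup u x"
  by (simp add: scale_def Poly_Mapping.map.rep_eq when_def)

lemma bilinear_ext_scale_left: "bilinear_ext b (scale c u) w = c * bilinear_ext b u w"
proof -
  have "Poly_Mapping.keys (scale c u) \<subseteq> Poly_Mapping.keys u"
    by (auto simp: in_keys_iff lookup_scale)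
  then show ?thesis
    by (simp add: bilinear_ext_superset[of "Poly_Mapping.keys u" _ "Poly_Mapping.keys w"]
        lookup_scale sum_distrib_left mult.assoc)
qed

lemma bilinear_ext_single:
  "bilinear_ext b (Poly_Mapping.single x 1) (Poly_Mapping.single y 1) = b x y"
  by (simp add: bilinear_ext_def)

section \<open>Isomorphisms, and the pairing as their number\<close>

lemma isosI:
  assumes "f \<in> extensional (fst P)" "bij_betw f (fst P) (fst Q)"
    "\<And>x y. x \<in> fst P \<Longrightarrow> y \<in> fst P \<Longrightarrow> (x, y) \<in> snd P \<longleftrightarrow> (f x, f y) \<in> snd Q"
  shows "f \<in> isos P Q"
  using assms by (auto simp: isos_def PiE_def bij_betw_def)

lemma isosD:
  assumes "f \<in> isos P Q"
  shows "f \<in> extensional (fst P)" "bij_betw f (fst P) (fst Q)" "f \<in> fst P \<rightarrow> fst Q"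
    "x \<in> fst P \<Longrightarrow> y \<in> fst P \<Longrightarrow> (x, y) \<in> snd P \<longleftrightarrow> (f x, f y) \<in> snd Q"
  using assms by (auto simp: isos_def PiE_def)

lemma finite_isos:
  assumes "finite (fst P)" "finite (fst Q)"
  shows "finite (isos P Q)"
proof (rule finite_subset)
  show "isos P Q \<subseteq> fst P \<rightarrow>\<^sub>E fst Q" by (auto simp: isos_def)
  show "finite (fst P \<rightarrow>\<^sub>E fst Q)" using assms by (simp add: finite_PiE)
qed

lemma isos_compose:
  assumes f: "f \<in> isos P Q" and g: "g \<in> isos Q R"
  shows "restrict (g \<circ> f) (fst P) \<in> isos P R"
proof (rule isosI)
  have "bij_betw (g \<circ> f) (fst P) (fst R)"
    using isosD(2)[OF f] isosD(2)[OF g] by (rule bij_betw_trans)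
  then show "bij_betw (restrict (g \<circ> f) (fst P)) (fst P) (fst R)"
    by (simp cong: bij_betw_cong)
qed (use isosD(3,4)[OF f] isosD(4)[OF g] in \<open>auto simp: Pi_def\<close>)

lemma isos_inverse:
  assumes f: "f \<in> isos P Q"
  shows "restrict (inv_into (fst P) f) (fst Q) \<in> isos Q P"
proof (rule isosI)
  note b = isosD(2)[OF f]
  show "bij_betw (restrict (inv_into (fst P) f) (fst Q)) (fst Q) (fst P)"
    using bij_betw_inv_into[OF b] by (simp cong: bij_betw_cong)
  fix x y assume xy: "x \<in> fst Q" "y \<in> fst Q"
  then have "inv_into (fst P) f x \<in> fst P" "inv_into (fst P) f y \<in> fst P"
    using bij_betwE[OF bij_betw_inv_into[OF b]] by auto
  then show "(x, y) \<in> snd Q \<longleftrightarrow> (restrict (inv_into (fst P) f) (fst Q) x,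
      restrict (inv_into (fst P) f) (fst Q) y) \<in> snd P"
    using isosD(4)[OF f] xy by (simp add: bij_betw_inv_into_right[OF b])
qed simp

text \<open>Once one isomorphism \<open>f\<close> is fixed, composing with \<open>f\<close> maps the
  automorphisms of \<open>P\<close> bijectively onto the isomorphisms from \<open>P\<close> to
  \<open>Q\<close>; the inverse is composition with the inverse of \<open>f\<close>. If there is no
  isomorphism, both sides are 0.\<close>

lemma poset_pairing_eq_card_isos: "poset_pairing P Q = of_nat (card (isos P Q))"
proof (cases "isos P Q = {}")
  case False
  then obtain f where f: "f \<in> isos P Q" by blast
  note b = isosD(2)[OF f]
  let ?h = "restrict (inv_into (fst P) f) (fst Q)"
  have "bij_betw (\<lambda>g. restrict (f \<circ> g) (fst P)) (isos P P) (isos P Q)"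
  proof (rule bij_betw_byWitness[where f' = "\<lambda>g. restrict (?h \<circ> g) (fst P)"])
    show "\<forall>g\<in>isos P P. restrict (?h \<circ> restrict (f \<circ> g) (fst P)) (fst P) = g"
    proof
      fix g assume g: "g \<in> isos P P"
      then show "restrict (?h \<circ> restrict (f \<circ> g) (fst P)) (fst P) = g"
        using isosD(1,3)[OF g] isosD(3)[OF f] bij_betw_inv_into_left[OF b]
        by (intro extensionalityI[of _ "fst P"]) (auto simp: Pi_def)
    qed
    show "\<forall>g\<in>isos P Q. restrict (f \<circ> restrict (?h \<circ> g) (fst P)) (fst P) = g"
    proof
      fix g assume g: "g \<in> isos P Q"
      then show "restrict (f \<circ> restrict (?h \<circ> g) (fst P)) (fst P) = g"
        using isosD(1,3)[OF g] bij_betw_inv_into_right[OF b]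
        by (intro extensionalityI[of _ "fst P"]) (auto simp: Pi_def)
    qed
  qed (use isos_compose f isos_inverse[OF f] in blast)+
  then show ?thesis
    using False by (simp add: poset_pairing_def isomorphic_def sigma_def Aut_def bij_betw_same_card)
qed (simp add: poset_pairing_def isomorphic_def)

section \<open>Induced subposets, zigzag paths and components\<close>

lemma fst_subposet [simp]: "fst (subposet P S) = S"
  and snd_subposet [simp]: "snd (subposet P S) = Restr (snd P) S"
  by (simp_all add: subposet_def)

text \<open>A path in \<open>Q\<close> is pulled back along \<open>f\<close> one step at a time. The
  assumption on \<open>snd Q\<close> keeps the intermediate vertices inside the image of
  \<open>f\<close>.\<close>

lemma zigzag_iso:
  assumes f: "f \<in> isos P Q" and x: "x \<in> fst P" and y: "y \<in> fst P"
    and "(f x, f y) \<in> zigzag Q" and sub: "snd Q \<subseteq> fst Q \<times> fst Q"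
  shows "(x, y) \<in> zigzag P"
proof -
  note b = isosD(2)[OF f]
  have "(f x, f y) \<in> (snd Q \<union> (snd Q)\<inverse>)\<^sup>*" using assms(4) by (simp add: zigzag_def)
  \<comment> \<open>The path runs in \<open>Q\<close>, so the induction has to speak of the
    preimages \<open>z\<close> of its current end point.\<close>
  then have "\<forall>z\<in>fst P. f z = f y \<longrightarrow> (x, z) \<in> (snd P \<union> (snd P)\<inverse>)\<^sup>*"
  proof (induction rule: rtrancl_induct)
    case base
    then show ?case using b x by (auto simp: bij_betw_def inj_on_def)
  next
    case (step p q)
    show ?case
    proof (intro ballI impI)
      fix z assume z: "z \<in> fst P" "f z = q"
      have "p \<in> f ` fst P" using step.hyps(2) sub b by (auto simp: bij_betw_def)
      then obtain w where w: "w \<in> fst P" "f w = p" by auto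
      then have "(w, z) \<in> snd P \<union> (snd P)\<inverse>"
        using step.hyps(2) z isosD(4)[OF f] by auto
      moreover have "(x, w) \<in> (snd P \<union> (snd P)\<inverse>)\<^sup>*" using step.IH w by blast
      ultimately show "(x, z) \<in> (snd P \<union> (snd P)\<inverse>)\<^sup>*" by (rule rtrancl_into_rtrancl[rotated])
    qed
  qed
  then show ?thesis using x y by (simp add: zigzag_def)
qed

lemma components_closed:
  assumes I: "I \<in> components P" and x: "x \<in> I" and y: "y \<in> fst P"
    and xy: "(x, y) \<in> snd P \<or> (y, x) \<in> snd P"
  shows "y \<in> I"
proof -
  obtain z where z: "z \<in> fst P" and I: "I = zigzag P `` {z}"
    using I by (auto simp: components_def quotient_def)
  have "(z, x) \<in> (snd P \<union> (snd P)\<inverse>)\<^sup>*" using x I by (simp add: zigzag_def)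
  then have "(z, y) \<in> (snd P \<union> (snd P)\<inverse>)\<^sup>*"
    by (rule rtrancl_into_rtrancl) (use xy in auto)
  then show ?thesis using z y I by (simp add: zigzag_def)
qed

text \<open>Closure under comparability prevents a path starting at \<open>z\<close> from leaving
  \<open>I\<close>, so the class of \<open>z\<close> lies in \<open>I\<close>; \<open>conn\<close>
  gives the reverse inclusion.\<close>

lemma componentsI:
  assumes "I \<subseteq> fst P" "z \<in> I"
    and conn: "\<And>x. x \<in> I \<Longrightarrow> (z, x) \<in> zigzag P"
    and closed: "\<And>x y. x \<in> I \<Longrightarrow> (x, y) \<in> snd P \<or> (y, x) \<in> snd P \<Longrightarrow> y \<in> I"
  shows "I \<in> components P"
proof -
  have "x \<in> I" if "(z, x) \<in> (snd P \<union> (snd P)\<inverse>)\<^sup>*" for x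
    using that by (induction rule: rtrancl_induct) (use assms(2) closed in auto)
  then have "I = zigzag P `` {z}" using conn by (auto simp: zigzag_def)
  then show ?thesis using assms(1,2) by (auto simp: components_def quotient_def)
qed

text \<open>Serves to pass from connectedness of \<open>cut f\<close> on its own to connectedness
  inside the larger set strictly above its lower part.\<close>

lemma zigzag_subposet_mono:
  assumes "S \<subseteq> T"
  shows "zigzag (subposet P S) \<subseteq> zigzag (subposet P T)"
proof -
  have "(Restr (snd P) S \<union> (Restr (snd P) S)\<inverse>)\<^sup>* \<subseteq> (Restr (snd P) T \<union> (Restr (snd P) T)\<inverse>)\<^sup>*"
    using assms by (intro rtrancl_mono) auto
  then show ?thesis using assms by (auto simp: zigzag_def)
qed

section \<open>Hasse graphs of finite posets and the order of a grafting\<close>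

lemma partial_order_onD:
  assumes "partial_order_on A r"
  shows "r \<subseteq> A \<times> A" "x \<in> A \<Longrightarrow> (x, x) \<in> r"
    "(x, y) \<in> r \<Longrightarrow> (y, z) \<in> r \<Longrightarrow> (x, z) \<in> r"
    "(x, y) \<in> r \<Longrightarrow> (y, x) \<in> r \<Longrightarrow> x = y"
  using assms by (auto simp: partial_order_on_def preorder_on_def refl_on_def trans_def antisym_def)

text \<open>Induction on the size of the interval from \<open>x\<close> to \<open>y\<close>. If the
  pair is neither trivial nor an edge, some \<open>z\<close> lies strictly between, and both
  subintervals are smaller: the first misses \<open>y\<close>, the second misses
  \<open>x\<close>.\<close>

lemma hasse_rtrancl:
  assumes fin: "finite (fst P)" and po: "partial_order_on (fst P) (snd P)" and "(x, y) \<in> snd P"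
  shows "(x, y) \<in> (hasse P)\<^sup>*"
  using assms(3)
proof (induction "card {z. (x, z) \<in> snd P \<and> (z, y) \<in> snd P}" arbitrary: x y rule: less_induct)
  case less
  note D = partial_order_onD[OF po]
  let ?J = "\<lambda>x y. {z. (x, z) \<in> snd P \<and> (z, y) \<in> snd P}"
  have finJ: "finite (?J x y)" for x y
    by (rule finite_subset[OF _ fin]) (use D(1) in auto)
  have ends: "(x, x) \<in> snd P" "(y, y) \<in> snd P" using less.prems D(1,2) by auto
  show ?case
  proof (cases "x = y \<or> (x, y) \<in> hasse P")
    case False
    then obtain z where z: "(x, z) \<in> snd P" "(z, y) \<in> snd P" "z \<noteq> x" "z \<noteq> y"
      using less.prems by (auto simp: hasse_def)
    have "?J x z \<subset> ?J x y" using z ends D(3,4) by blast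
    then have "(x, z) \<in> (hasse P)\<^sup>*" using less.hyps z finJ by (meson psubset_card_mono)
    moreover have "?J z y \<subset> ?J x y" using z ends D(3,4) by blast
    then have "(z, y) \<in> (hasse P)\<^sup>*" using less.hyps z finJ by (meson psubset_card_mono)
    ultimately show ?thesis by simp
  qed auto
qed

text \<open>Descent on the size of the principal down-set: for \<open>y\<close> strictly below
  \<open>x\<close>, the down-set of \<open>y\<close> misses \<open>x\<close>.\<close>

lemma ex_min_elem_below:
  assumes fin: "finite (fst P)" and po: "partial_order_on (fst P) (snd P)" and "x \<in> fst P"
  shows "\<exists>m\<in>min_elems P. (m, x) \<in> snd P"
  using assms(3)
proof (induction "card {z. (z, x) \<in> snd P}" arbitrary: x rule: less_induct)
  case less
  note D = partial_order_onD[OF po]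
  have finJ: "finite {z. (z, x) \<in> snd P}" for x
    by (rule finite_subset[OF _ fin]) (use D(1) in auto)
  show ?case
  proof (cases "x \<in> min_elems P")
    case False
    then obtain y where y: "y \<in> fst P" "(y, x) \<in> snd P" "y \<noteq> x"
      using less.prems by (auto simp: min_elems_def)
    have "{z. (z, y) \<in> snd P} \<subset> {z. (z, x) \<in> snd P}"
      using y less.prems D(2,3,4) by blast
    then show ?thesis using less.hyps y finJ D(3) by (meson psubset_card_mono)
  qed (use D(2) less.prems in auto)
qed

lemma fst_graft [simp]: "fst (graft Q v R) = fst Q <+> fst R"
  by (simp add: graft_def)

text \<open>Replaces reachability by an explicit order. Since \<open>v\<close> is minimal in
  \<open>R\<close>, no other point of \<open>R\<close> reaches \<open>Q\<close> through
  \<open>v\<close>, so the mixed relations are exactly those from \<open>v\<close> to the points of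
  \<open>Q\<close>.\<close>

lemma snd_graft:
  assumes Q: "finite (fst Q)" "partial_order_on (fst Q) (snd Q)"
    and R: "finite (fst R)" "partial_order_on (fst R) (snd R)" and v: "v \<in> min_elems R"
  shows "snd (graft Q v R) =
    map_prod Inl Inl ` snd Q \<union> map_prod Inr Inr ` snd R \<union> {Inr v} \<times> Inl ` fst Q"
    (is "_ = ?T")
proof
  note DQ = partial_order_onD[OF Q(2)] and DR = partial_order_onD[OF R(2)]
  let ?E = "graft_edges Q v R"
  have minv: "a = v" if "(a, v) \<in> snd R" for a
    using that v DR(1) by (auto simp: min_elems_def)
  have TL: "(a, Inl y) \<in> ?T \<longleftrightarrow> (\<exists>x. a = Inl x \<and> (x, y) \<in> snd Q) \<or> a = Inr v \<and> y \<in> fst Q" for a y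
    by auto
  have TR: "(a, Inr y) \<in> ?T \<longleftrightarrow> (\<exists>x. a = Inr x \<and> (x, y) \<in> snd R)" for a y
    by auto
  \<comment> \<open>\<open>?T\<close> absorbs one more edge at the end of a path. Edges inside
    \<open>Q\<close> or \<open>R\<close> use transitivity there; for an edge leaving
    \<open>v\<close>, the start \<open>a\<close> can only be \<open>Inr v\<close>, by
    \<open>minv\<close>.\<close>
  have step: "(a, c) \<in> ?T" if ab: "(a, b) \<in> ?T" and bc: "(b, c) \<in> ?E" for a b c
  proof -
    consider x y where "b = Inl x" "c = Inl y" "(x, y) \<in> snd Q"
      | x y where "b = Inr x" "c = Inr y" "(x, y) \<in> snd R"
      | y where "b = Inr v" "c = Inl y" "y \<in> fst Q"
      using bc by (auto simp: graft_edges_def hasse_def min_elems_def)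
    then show ?thesis
    proof cases
      case 1
      then have "y \<in> fst Q" using DQ(1) by blast
      then show ?thesis using ab 1 DQ(3) unfolding 1 TL by blast
    next
      case 2
      then show ?thesis using ab DR(3) unfolding 2 TR by blast
    next
      case 3
      then show ?thesis using ab minv unfolding 3 TL TR by blast
    qed
  qed
  \<comment> \<open>The closure also contains loops at points off the carrier, which
    \<open>?T\<close> lacks; hence the condition on \<open>a\<close>.\<close>
  have "(a, b) \<in> ?T" if "(a, b) \<in> ?E\<^sup>*" "a \<in> fst Q <+> fst R" for a b
    using that(1)
  proof (induction rule: rtrancl_induct)
    case base
    then show ?case using that(2) DQ(2) DR(2) by (auto simp: Plus_def)
  qed (use step in blast)
  then show "snd (graft Q v R) \<subseteq> ?T" by (auto simp: graft_def)
  have left: "(Inl a, Inl b) \<in> ?E\<^sup>*" if "(a, b) \<in> snd Q" for a b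
    using hasse_rtrancl[OF Q that]
  proof (induction rule: rtrancl_induct)
    case (step b c)
    then have "(Inl b, Inl c) \<in> ?E" by (force simp: graft_edges_def)
    with step.IH show ?case by (rule rtrancl_into_rtrancl)
  qed simp
  have right: "(Inr a, Inr b) \<in> ?E\<^sup>*" if "(a, b) \<in> snd R" for a b
    using hasse_rtrancl[OF R that]
  proof (induction rule: rtrancl_induct)
    case (step b c)
    then have "(Inr b, Inr c) \<in> ?E" by (force simp: graft_edges_def)
    with step.IH show ?case by (rule rtrancl_into_rtrancl)
  qed simp
  have cross: "(Inr v, Inl b) \<in> ?E\<^sup>*" if b: "b \<in> fst Q" for b
  proof -
    \<comment> \<open>Only minimal elements of \<open>Q\<close> receive an edge from
      \<open>v\<close>, so the path to \<open>b\<close> enters \<open>Q\<close> at a minimal element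
      below \<open>b\<close>.\<close>
    obtain m where m: "m \<in> min_elems Q" "(m, b) \<in> snd Q" using ex_min_elem_below[OF Q b] by blast
    then have "(Inr v, Inl m) \<in> ?E" by (simp add: graft_edges_def)
    then show ?thesis using left[OF m(2)] by (rule converse_rtrancl_into_rtrancl)
  qed
  show "?T \<subseteq> snd (graft Q v R)"
    using left right cross DQ(1) DR(1) v by (auto simp: graft_def min_elems_def)
qed

section \<open>Isomorphisms onto a grafting and admissible subsets\<close>

context
  fixes P :: "'p poset" and Q :: "'q poset" and R :: "'r poset"
  assumes P: "finite_connected_poset P" and Q: "finite_connected_poset Q"
    and R: "finite_connected_poset R"
begin

lemma posets:
  "partial_order_on (fst P) (snd P)" "partial_order_on (fst Q) (snd Q)"
  "partial_order_on (fst R) (snd R)" "finite (fst P)" "finite (fst Q)" "finite (fst R)"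
  using P Q R by (auto simp: finite_connected_poset_def)

lemmas orderP = partial_order_onD[OF posets(1)]
lemmas orderQ = partial_order_onD[OF posets(2)]
lemmas orderR = partial_order_onD[OF posets(3)]

lemma graft_order:
  assumes "v \<in> min_elems R"
  shows "(Inl a, Inl b) \<in> snd (graft Q v R) \<longleftrightarrow> (a, b) \<in> snd Q"
    "(Inr c, Inr d) \<in> snd (graft Q v R) \<longleftrightarrow> (c, d) \<in> snd R"
    "(Inr c, Inl b) \<in> snd (graft Q v R) \<longleftrightarrow> c = v \<and> b \<in> fst Q"
    "(Inl a, Inr d) \<notin> snd (graft Q v R)"
  using snd_graft[OF posets(5,2,6,3) assms] by auto

definition cut :: "('p \<Rightarrow> 'q + 'r) \<Rightarrow> 'p set" where
  "cut f = {x \<in> fst P. isl (f x)}"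

text \<open>The vertex \<open>v\<close> is not stored: for an isomorphism onto
  \<open>graft Q v R\<close> with \<open>v\<close> minimal, it is the value of the last component at
  the unique element of \<open>lower_part P (cut f)\<close>. The restrictions make both maps
  extensional, as \<open>isos\<close> demands.\<close>

definition split_iso :: "('p \<Rightarrow> 'q + 'r) \<Rightarrow> 'p set \<times> ('p \<Rightarrow> 'q) \<times> ('p \<Rightarrow> 'r)" where
  "split_iso f =
    (cut f, restrict (projl \<circ> f) (cut f), restrict (projr \<circ> f) (fst P - cut f))"

definition glue :: "'p set \<Rightarrow> ('p \<Rightarrow> 'q) \<Rightarrow> ('p \<Rightarrow> 'r) \<Rightarrow> 'p \<Rightarrow> 'q + 'r" where
  "glue I g h = (\<lambda>x\<in>fst P. if x \<in> I then Inl (g x) else Inr (h x))"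

text \<open>Between points of the same summand the grafted order is that of \<open>Q\<close> or of
  \<open>R\<close>, so removing the tags from \<open>f\<close> preserves and reflects order.
  Surjectivity holds because \<open>f\<close> attains every \<open>Inl a\<close> and every
  \<open>Inr a\<close>.\<close>

lemma cut_isos:
  assumes v: "v \<in> min_elems R" and f: "f \<in> isos P (graft Q v R)"
  shows "restrict (projl \<circ> f) (cut f) \<in> isos (subposet P (cut f)) Q" (is ?g)
    and "restrict (projr \<circ> f) (fst P - cut f) \<in> isos (subposet P (fst P - cut f)) R" (is ?h)
proof -
  have inj: "inj_on f (fst P)" and im: "f ` fst P = fst Q <+> fst R"
    using isosD(2)[OF f] by (auto simp: bij_betw_def)
  have l: "\<exists>a\<in>fst Q. f x = Inl a" if "x \<in> cut f" for x
    using that im by (auto simp: cut_def isl_def)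
  have r: "\<exists>a\<in>fst R. f x = Inr a" if "x \<in> fst P" "x \<notin> cut f" for x
    using that im by (auto simp: cut_def isl_def)
  show ?g
  proof (rule isosI)
    have "inj_on (projl \<circ> f) (cut f)"
    proof (rule inj_onI)
      fix x y assume "x \<in> cut f" "y \<in> cut f" "(projl \<circ> f) x = (projl \<circ> f) y"
      then have "f x = f y" using l[of x] l[of y] by auto
      then show "x = y" using inj \<open>x \<in> cut f\<close> \<open>y \<in> cut f\<close> by (auto simp: cut_def inj_on_def)
    qed
    moreover have "(projl \<circ> f) ` cut f = fst Q"
    proof
      show "(projl \<circ> f) ` cut f \<subseteq> fst Q" using l by force
      show "fst Q \<subseteq> (projl \<circ> f) ` cut f"
      proof
        fix a assume "a \<in> fst Q"
        then have "Inl a \<in> f ` fst P" using im by auto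
        then obtain x where "x \<in> fst P" "f x = Inl a" by auto
        then show "a \<in> (projl \<circ> f) ` cut f" by (force simp: cut_def)
      qed
    qed
    ultimately show "bij_betw (restrict (projl \<circ> f) (cut f)) (fst (subposet P (cut f))) (fst Q)"
      by (simp add: bij_betw_def inj_on_restrict_eq)
    fix x y assume "x \<in> fst (subposet P (cut f))" "y \<in> fst (subposet P (cut f))"
    then show "(x, y) \<in> snd (subposet P (cut f)) \<longleftrightarrow>
        (restrict (projl \<circ> f) (cut f) x, restrict (projl \<circ> f) (cut f) y) \<in> snd Q"
      using l[of x] l[of y] isosD(4)[OF f, of x y] graft_order[OF v] by (auto simp: cut_def)
  qed simp
  show ?h
  proof (rule isosI)
    have "inj_on (projr \<circ> f) (fst P - cut f)"
    proof (rule inj_onI)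
      fix x y assume xy: "x \<in> fst P - cut f" "y \<in> fst P - cut f"
        and eq: "(projr \<circ> f) x = (projr \<circ> f) y"
      obtain a b where "f x = Inr a" "f y = Inr b" using xy r by blast
      then have "f x = f y" using eq by simp
      then show "x = y" using inj_onD[OF inj] xy by blast
    qed
    moreover have "(projr \<circ> f) ` (fst P - cut f) = fst R"
    proof
      show "(projr \<circ> f) ` (fst P - cut f) \<subseteq> fst R" using r by force
      show "fst R \<subseteq> (projr \<circ> f) ` (fst P - cut f)"
      proof
        fix a assume "a \<in> fst R"
        then have "Inr a \<in> f ` fst P" using im by auto
        then obtain x where "x \<in> fst P" "f x = Inr a" by auto
        then show "a \<in> (projr \<circ> f) ` (fst P - cut f)" by (force simp: cut_def)
      qed
    qed
    ultimately show "bij_betw (restrict (projr \<circ> f) (fst P - cut f))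
        (fst (subposet P (fst P - cut f))) (fst R)"
      by (simp add: bij_betw_def inj_on_restrict_eq)
    fix x y assume "x \<in> fst (subposet P (fst P - cut f))" "y \<in> fst (subposet P (fst P - cut f))"
    then show "(x, y) \<in> snd (subposet P (fst P - cut f)) \<longleftrightarrow>
        (restrict (projr \<circ> f) (fst P - cut f) x, restrict (projr \<circ> f) (fst P - cut f) y) \<in> snd R"
      using r[of x] r[of y] isosD(4)[OF f, of x y] graft_order[OF v] by auto
  qed simp
qed

text \<open>Here \<open>m\<close> is the preimage of \<open>Inr v\<close>. Every relation from an
  \<open>Inr\<close> point to an \<open>Inl\<close> point starts at \<open>v\<close>, so no other
  element outside the cut lies below the cut. Minimality of \<open>m\<close> is inherited from
  \<open>v\<close>, as no \<open>Inl\<close> point lies below an \<open>Inr\<close> point.\<close>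

lemma cut_lower_part:
  assumes v: "v \<in> min_elems R" and f: "f \<in> isos P (graft Q v R)"
  obtains m where "m \<in> fst P" "f m = Inr v" "lower_part P (cut f) = {m}" "m \<in> min_elems P"
    "\<And>x. x \<in> cut f \<Longrightarrow> (m, x) \<in> snd P"
proof -
  have inj: "inj_on f (fst P)" and im: "f ` fst P = fst Q <+> fst R"
    using isosD(2)[OF f] by (auto simp: bij_betw_def)
  have vR: "v \<in> fst R" using v by (simp add: min_elems_def)
  then have "Inr v \<in> f ` fst P" using im by auto
  then obtain m where m: "m \<in> fst P" "f m = Inr v" by auto
  have l: "\<exists>a\<in>fst Q. f x = Inl a" if "x \<in> cut f" for x
    using that im by (auto simp: cut_def isl_def)
  have above: "(m, x) \<in> snd P" if "x \<in> cut f" for x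
  proof -
    have "x \<in> fst P" using that by (simp add: cut_def)
    then show ?thesis
      using l[OF that] isosD(4)[OF f m(1), of x] m(2) graft_order(3)[OF v] by auto
  qed
  have below: "x = m" if x: "x \<in> fst P" "x \<notin> cut f" and y: "y \<in> cut f" and xy: "(x, y) \<in> snd P"
    for x y
  proof -
    obtain c where c: "f x = Inr c" using x by (cases "f x") (auto simp: cut_def)
    have "y \<in> fst P" using y by (simp add: cut_def)
    then have "c = v"
      using l[OF y] isosD(4)[OF f x(1), of y] xy c graft_order(3)[OF v] by auto
    then show ?thesis using inj c m x(1) by (auto simp: inj_on_def)
  qed
  \<comment> \<open>A point of the cut is needed to witness that \<open>m\<close> belongs to the
    lower part.\<close>
  have "fst Q \<noteq> {}" using Q by (simp add: finite_connected_poset_def)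
  then obtain a where "Inl a \<in> f ` fst P" using im by auto
  then obtain z where "z \<in> fst P" "f z = Inl a" by auto
  then have z: "z \<in> cut f" by (simp add: cut_def)
  have "lower_part P (cut f) = {m}"
  proof
    show "lower_part P (cut f) \<subseteq> {m}" using below unfolding lower_part_def by blast
    have "m \<notin> cut f" using m(2) by (simp add: cut_def)
    then show "{m} \<subseteq> lower_part P (cut f)"
      using above[OF z] z m(1) unfolding lower_part_def by blast
  qed
  moreover have "m \<in> min_elems P"
  proof -
    have "y = m" if y: "y \<in> fst P" "(y, m) \<in> snd P" for y
    proof -
      have "(f y, Inr v) \<in> snd (graft Q v R)" using isosD(4)[OF f y(1) m(1)] y(2) m(2) by simp
      then obtain c where c: "f y = Inr c" "(c, v) \<in> snd R"
        using graft_order[OF v] by (cases "f y") auto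
      then have "c = v" using v orderR(1) by (auto simp: min_elems_def)
      then show ?thesis using inj c m y by (auto simp: inj_on_def)
    qed
    then show ?thesis using m by (simp add: min_elems_def)
  qed
  ultimately show thesis using that m above by blast
qed

text \<open>The cut is connected as a copy of \<open>Q\<close>, and it is a whole component of the
  set strictly above \<open>m\<close> because its only link to the rest of \<open>P\<close> is
  \<open>m\<close> itself.\<close>

lemma cut_admissible:
  assumes v: "v \<in> min_elems R" and f: "f \<in> isos P (graft Q v R)"
  shows "admissible (cut f) P"
proof -
  obtain m where m: "m \<in> fst P" "f m = Inr v" "lower_part P (cut f) = {m}" "m \<in> min_elems P"
    and above: "\<And>x. x \<in> cut f \<Longrightarrow> (m, x) \<in> snd P"
    using cut_lower_part[OF v f] by blast
  note g = cut_isos(1)[OF v f]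
  let ?g = "restrict (projl \<circ> f) (cut f)"
  let ?S = "{x \<in> fst P. (m, x) \<in> snd P \<and> m \<noteq> x}"
  have inj: "inj_on f (fst P)"
    using isosD(2)[OF f] by (auto simp: bij_betw_def)
  have sub: "cut f \<subseteq> ?S" using above m(2) by (auto simp: cut_def)
  have gim: "?g ` cut f = fst Q" using isosD(2)[OF g] by (simp add: bij_betw_def)
  have "fst Q \<noteq> {}" using Q by (simp add: finite_connected_poset_def)
  then obtain z where z: "z \<in> cut f" using gim by blast
  have "cut f \<in> components (subposet P ?S)"
  proof (rule componentsI[OF _ z])
    show "cut f \<subseteq> fst (subposet P ?S)" using sub by simp
  next
    fix x assume x: "x \<in> cut f"
    then have "?g x \<in> fst Q" "?g z \<in> fst Q" using gim z by blast+
    then have "(?g z, ?g x) \<in> zigzag Q" using Q unfolding finite_connected_poset_def by blast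
    then have "(z, x) \<in> zigzag (subposet P (cut f))"
      using zigzag_iso[OF g] z x orderQ(1) by simp
    then show "(z, x) \<in> zigzag (subposet P ?S)" using zigzag_subposet_mono[OF sub] by blast
  next
    fix x y assume x: "x \<in> cut f" and xy: "(x, y) \<in> snd (subposet P ?S) \<or> (y, x) \<in> snd (subposet P ?S)"
    have xP: "x \<in> fst P" and yP: "y \<in> fst P" using x xy by (auto simp: cut_def)
    obtain a where a: "f x = Inl a" using x by (auto simp: cut_def isl_def)
    show "y \<in> cut f"
    \<comment> \<open>A neighbour outside the cut must be sent to \<open>Inr v\<close> and hence
      equals \<open>m\<close>, which the strict inequality keeps out of \<open>?S\<close>.\<close>
    proof (rule ccontr)
      assume "y \<notin> cut f"
      then obtain c where c: "f y = Inr c" using yP by (cases "f y") (auto simp: cut_def)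
      have "(f x, f y) \<in> snd (graft Q v R) \<or> (f y, f x) \<in> snd (graft Q v R)"
        using xy isosD(4)[OF f] xP yP by auto
      then have "c = v" using a c graft_order[OF v] by auto
      then have "y = m" using c m inj yP by (auto simp: inj_on_def)
      then show False using xy by auto
    qed
  qed
  then show ?thesis
    using m sub by (auto simp: admissible_def)
qed

text \<open>Extracts the order conditions needed for gluing: \<open>I\<close> is an up-set, and
  \<open>m\<close> lies below all of \<open>I\<close> while no other outside element lies below any
  of it. This determines every relation between \<open>I\<close> and its complement.\<close>

lemma admissibleE:
  assumes "admissible I P"
  obtains m where "lower_part P I = {m}" "m \<in> min_elems P" "m \<in> fst P" "m \<notin> I" "I \<subseteq> fst P"
    "\<And>x. x \<in> I \<Longrightarrow> (m, x) \<in> snd P"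
    "\<And>x y. x \<in> I \<Longrightarrow> y \<in> fst P \<Longrightarrow> (x, y) \<in> snd P \<Longrightarrow> y \<in> I"
    "\<And>x y. x \<in> I \<Longrightarrow> y \<in> fst P - I \<Longrightarrow> (y, x) \<in> snd P \<Longrightarrow> y = m"
proof -
  obtain m where m: "lower_part P I = {m}" using assms by (auto simp: admissible_def is_singleton_def)
  let ?S = "{x \<in> fst P. (m, x) \<in> snd P \<and> m \<noteq> x}"
  have I: "I \<subseteq> fst P" "I \<in> components (subposet P ?S)" "m \<in> min_elems P"
    using assms m by (auto simp: admissible_def)
  have mP: "m \<in> fst P" "m \<notin> I" using m by (auto simp: lower_part_def)
  have IS: "I \<subseteq> ?S"
    using I(2) by (auto simp: components_def quotient_def zigzag_def)
  \<comment> \<open>By transitivity and antisymmetry an element above \<open>x\<close> is again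
    strictly above \<open>m\<close>, so it lies in the same component as \<open>x\<close>.\<close>
  have closed: "y \<in> I" if "x \<in> I" "y \<in> fst P" "(x, y) \<in> snd P" for x y
  proof (rule components_closed[OF I(2) that(1)])
    have x: "x \<in> ?S" using IS that by blast
    then have y: "y \<in> ?S" using that orderP(3,4) by blast
    then show "y \<in> fst (subposet P ?S)" by simp
    show "(x, y) \<in> snd (subposet P ?S) \<or> (y, x) \<in> snd (subposet P ?S)" using x y that by simp
  qed
  have low: "y = m" if "x \<in> I" "y \<in> fst P - I" "(y, x) \<in> snd P" for x y
  proof -
    have "y \<in> lower_part P I" using that by (auto simp: lower_part_def)
    then show ?thesis using m by simp
  qed
  show thesis by (rule that[OF m I(3) mP I(1)]) (use IS closed low in auto)
qed

text \<open>Relations inside \<open>I\<close> and inside its complement are carried over by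
  \<open>g\<close> and \<open>h\<close>. The mixed relations say that \<open>m\<close> is below
  \<open>I\<close>, which matches the grafted order when the vertex is the image of \<open>m\<close>
  under \<open>h\<close>.\<close>

lemma glue_isos:
  assumes I: "admissible I P" and g: "g \<in> isos (subposet P I) Q"
    and h: "h \<in> isos (subposet P (fst P - I)) R"
  shows "h (the_elem (lower_part P I)) \<in> min_elems R"
    and "glue I g h \<in> isos P (graft Q (h (the_elem (lower_part P I))) R)"
proof -
  obtain m where m: "lower_part P I = {m}" "m \<in> min_elems P" "m \<in> fst P" "m \<notin> I" "I \<subseteq> fst P"
    and above: "\<And>x. x \<in> I \<Longrightarrow> (m, x) \<in> snd P"
    and up: "\<And>x y. x \<in> I \<Longrightarrow> y \<in> fst P \<Longrightarrow> (x, y) \<in> snd P \<Longrightarrow> y \<in> I"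
    and low: "\<And>x y. x \<in> I \<Longrightarrow> y \<in> fst P - I \<Longrightarrow> (y, x) \<in> snd P \<Longrightarrow> y = m"
    using admissibleE[OF I] by blast
  have gb: "inj_on g I" "g ` I = fst Q" using isosD(2)[OF g] by (auto simp: bij_betw_def)
  have hb: "inj_on h (fst P - I)" "h ` (fst P - I) = fst R"
    using isosD(2)[OF h] by (auto simp: bij_betw_def)
  have ho: "(x, y) \<in> snd P \<longleftrightarrow> (h x, h y) \<in> snd R" if "x \<in> fst P - I" "y \<in> fst P - I" for x y
    using isosD(4)[OF h, of x y] that by simp
  have go: "(x, y) \<in> snd P \<longleftrightarrow> (g x, g y) \<in> snd Q" if "x \<in> I" "y \<in> I" for x y
    using isosD(4)[OF g, of x y] that by simp
  have "h m \<in> min_elems R"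
    unfolding min_elems_def
  proof (intro CollectI conjI ballI impI)
    show "h m \<in> fst R" using hb m by blast
    fix y assume y: "y \<in> fst R" "(y, h m) \<in> snd R"
    \<comment> \<open>An element of \<open>R\<close> below \<open>h m\<close> is the image of some
      \<open>x\<close> below \<open>m\<close>, so minimality of \<open>m\<close> in \<open>P\<close>
      gives that of \<open>h m\<close> in \<open>R\<close>.\<close>
    then obtain x where x: "x \<in> fst P - I" "y = h x" using hb by blast
    then have "(x, m) \<in> snd P" using y ho m by auto
    then show "y = h m" using x m by (auto simp: min_elems_def)
  qed
  then show v: "h (the_elem (lower_part P I)) \<in> min_elems R" using m by simp
  show "glue I g h \<in> isos P (graft Q (h (the_elem (lower_part P I))) R)"
  proof (rule isosI)
    show "glue I g h \<in> extensional (fst P)" by (simp add: glue_def)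
    have "inj_on (glue I g h) (fst P)"
      using gb hb by (auto simp: inj_on_def glue_def)
    moreover have "glue I g h ` fst P = fst Q <+> fst R"
    proof -
      have "glue I g h ` fst P = glue I g h ` I \<union> glue I g h ` (fst P - I)" using m(5) by blast
      also have "glue I g h ` I = Inl ` g ` I"
        using m(5) by (force simp: glue_def)
      also have "glue I g h ` (fst P - I) = Inr ` h ` (fst P - I)"
        by (force simp: glue_def)
      finally show ?thesis using gb hb by (simp add: Plus_def)
    qed
    ultimately show "bij_betw (glue I g h) (fst P)
        (fst (graft Q (h (the_elem (lower_part P I))) R))"
      by (simp add: bij_betw_def)
    fix x y assume xy: "x \<in> fst P" "y \<in> fst P"
    \<comment> \<open>Translates the condition for a mixed relation in the grafting,
      \<open>h x = h m\<close>, into \<open>x = m\<close>, where \<open>above\<close> and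
      \<open>low\<close> apply.\<close>
    have hm: "h x = h m \<longleftrightarrow> x = m" if "x \<notin> I" using that xy m hb by (auto simp: inj_on_def)
    show "(x, y) \<in> snd P \<longleftrightarrow> (glue I g h x, glue I g h y)
        \<in> snd (graft Q (h (the_elem (lower_part P I))) R)"
    proof (cases "x \<in> I"; cases "y \<in> I")
      assume I: "x \<in> I" "y \<in> I"
      then show ?thesis using xy go[OF I] graft_order(1)[OF v] by (simp add: glue_def)
    next
      assume "x \<in> I" "y \<notin> I"
      moreover from this have "(x, y) \<notin> snd P" using up xy by blast
      ultimately show ?thesis using xy graft_order(4)[OF v] by (simp add: glue_def)
    next
      assume I: "x \<notin> I" "y \<notin> I"
      then show ?thesis using xy ho[of x y] graft_order(2)[OF v] by (simp add: glue_def)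
    next
      assume "x \<notin> I" "y \<in> I"
      moreover have "g y \<in> fst Q" using gb \<open>y \<in> I\<close> by blast
      ultimately show ?thesis
        using xy m(1) graft_order(3)[OF v] hm above low by (auto simp: glue_def)
    qed
  qed
qed

text \<open>Each side is the cardinality of a disjoint union: triples \<open>(I, g, h)\<close> on
  the left, pairs \<open>(v, f)\<close> on the right. Gluing and splitting are mutually inverse
  bijections between them.\<close>

lemma card_isos_graft:
  "(\<Sum>I | admissible I P. card (isos (subposet P I) Q) * card (isos (subposet P (fst P - I)) R))
    = (\<Sum>v\<in>min_elems R. card (isos P (graft Q v R)))"
proof -
  let ?A = "SIGMA I:{I. admissible I P}. isos (subposet P I) Q \<times> isos (subposet P (fst P - I)) R"
  let ?B = "SIGMA v:min_elems R. isos P (graft Q v R)"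
  let ?F = "\<lambda>(I, g, h). (h (the_elem (lower_part P I)), glue I g h)"
  have finA: "finite {I. admissible I P}"
    by (rule finite_subset[of _ "Pow (fst P)"]) (use posets in \<open>auto simp: admissible_def\<close>)
  have finR: "finite (min_elems R)" using posets(6) by (simp add: min_elems_def)
  have split_glue: "split_iso (glue I g h) = (I, g, h)"
    if I: "admissible I P" and g: "g \<in> isos (subposet P I) Q"
      and h: "h \<in> isos (subposet P (fst P - I)) R" for I g h
  proof -
    have sub: "I \<subseteq> fst P" using I by (simp add: admissible_def)
    then have "cut (glue I g h) = I" by (auto simp: cut_def glue_def)
    moreover have "restrict (projl \<circ> glue I g h) I = g"
      using isosD(1)[OF g] sub
      by (intro extensionalityI[of _ I]) (auto simp: glue_def)
    moreover have "restrict (projr \<circ> glue I g h) (fst P - I) = h"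
      using isosD(1)[OF h]
      by (intro extensionalityI[of _ "fst P - I"]) (auto simp: glue_def)
    ultimately show ?thesis by (simp add: split_iso_def)
  qed
  have glue_split: "?F (split_iso f) = (v, f)"
    if v: "v \<in> min_elems R" and f: "f \<in> isos P (graft Q v R)" for v f
  proof -
    obtain m where m: "m \<in> fst P" "f m = Inr v" "lower_part P (cut f) = {m}"
      using cut_lower_part[OF v f] by blast
    \<comment> \<open>Being outside the cut, \<open>m\<close> is in the domain of the restricted
      right projection, whose value there is \<open>projr (Inr v)\<close>, that is
      \<open>v\<close>.\<close>
    have "m \<notin> cut f" using m by (simp add: cut_def)
    moreover have "glue (cut f) (restrict (projl \<circ> f) (cut f))
        (restrict (projr \<circ> f) (fst P - cut f)) = f"
    proof (rule extensionalityI[of _ "fst P"])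
      show "f \<in> extensional (fst P)" by (rule isosD(1)[OF f])
      fix x assume "x \<in> fst P"
      then show "glue (cut f) (restrict (projl \<circ> f) (cut f))
          (restrict (projr \<circ> f) (fst P - cut f)) x = f x"
        by (cases "f x") (auto simp: glue_def cut_def)
    qed (simp add: glue_def)
    ultimately show ?thesis using m by (simp add: split_iso_def)
  qed
  have "bij_betw ?F ?A ?B"
  proof (rule bij_betw_byWitness[where f' = "\<lambda>(v, f). split_iso f"])
    show "\<forall>a\<in>?A. (\<lambda>(v, f). split_iso f) (?F a) = a" using split_glue by auto
    show "\<forall>b\<in>?B. ?F ((\<lambda>(v, f). split_iso f) b) = b" using glue_split by auto
    show "?F ` ?A \<subseteq> ?B" using glue_isos by auto
    show "(\<lambda>(v, f). split_iso f) ` ?B \<subseteq> ?A"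
      using cut_admissible cut_isos by (auto simp: split_iso_def)
  qed
  then have "card ?A = card ?B" by (rule bij_betw_same_card)
  moreover have "card ?A = (\<Sum>I | admissible I P.
      card (isos (subposet P I) Q \<times> isos (subposet P (fst P - I)) R))"
  proof (rule card_SigmaI[OF finA], rule ballI)
    fix I assume "I \<in> {I. admissible I P}"
    then have "finite I" using posets(4) by (auto simp: admissible_def intro: finite_subset)
    then show "finite (isos (subposet P I) Q \<times> isos (subposet P (fst P - I)) R)"
      using posets by (simp add: finite_isos)
  qed
  moreover have "card ?B = (\<Sum>v\<in>min_elems R. card (isos P (graft Q v R)))"
    using finR posets by (intro card_SigmaI) (auto intro!: finite_isos)
  ultimately show ?thesis by (simp add: card_cartesian_product)
qed

end

theorem theorem3p18:
  fixes P :: "'p poset" and Q :: "'q poset" and R :: "'r poset"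
  assumes "finite_connected_poset P"
    and "finite_connected_poset Q"
    and "finite_connected_poset R"
  shows "tensor_pairing (delta P) (tensor Q R) =
    (1 / of_nat (card (min_elems P)) * pairing (basis P) (tri_prod Q R) :: 'k::field_char_0)"
proof -
  let ?c = "1 / of_nat (card (min_elems P)) :: 'k"
  have "tensor_pairing (delta P) (tensor Q R) = ?c * (\<Sum>I | admissible I P.
      poset_pairing (subposet P I) Q * poset_pairing (subposet P (fst P - I)) R)"
    by (simp add: tensor_pairing_def delta_def tensor_def bilinear_ext_scale_left
        bilinear_ext_sum_left bilinear_ext_single)
  \<comment> \<open>With the common factor pulled out, what remains is an equality of natural
    numbers counting isomorphisms.\<close>
  also have "\<dots> = ?c * of_nat (\<Sum>I | admissible I P.
      card (isos (subposet P I) Q) * card (isos (subposet P (fst P - I)) R))"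
    by (simp add: poset_pairing_eq_card_isos)
  also have "\<dots> = ?c * of_nat (\<Sum>v\<in>min_elems R. card (isos P (graft Q v R)))"
    by (simp only: card_isos_graft[OF assms])
  also have "\<dots> = ?c * pairing (basis P) (tri_prod Q R)"
    by (simp add: pairing_def basis_def tri_prod_def bilinear_ext_sum_right bilinear_ext_single
        poset_pairing_eq_card_isos)
  finally show ?thesis .
qed

end
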